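(* For every finite simple graph $G$, the following statements are equivalent: (1) $G$ is a threshold graph; (2) the vertex cover hypergraph $\mathcal{VC}(G)$ is $1$-Sperner; (3) the vertex cover hypergraph $\mathcal{VC}(G)$ is threshold; (4) the vertex cover hypergraph $\mathcal{VC}(G)$ is $2$-asummable.
   Context: A hypergraph $\mathcal{H}=(V,E)$ consists of a finite vertex set $V$ and a set $E$ of subsets of $V$ (hyperedges). $\mathcal{H}$ is $1$-Sperner if every two distinct hyperedges $e,f$ satisfy $\min\{|e\setminus f|,|f\setminus e|\}=1$. A set $X\subseteq V$ is independent in $\mathcal{H}$ if it contains no hyperedge, and dependent otherwise. $\mathcal{H}$ is threshold if there exist $w:V\to\mathbb{Z}_{\ge0}$ and $t\in\mathbb{Z}_{\ge0}$ such that for every $X\subseteq V$, $\sum_{x\in X}w(x)\ge t$ if and only if $X$ contains some hyperedge. $\mathcal{H}$ is $2$-asummable if there are no (not necessarily distinct) independent sets $A_1,A_2$ and dependent sets $B_1,B_2$ with $\chi^{A_1}+\chi^{A_2}=\chi^{B_1}+\chi^{B_2}$, where $\chi^S\in\{0,1\}^V$ is the characteristic vector of $S$. A graph $G=(V,E)$ is threshold if there exist $w:V\to\mathbb{Z}_{\ge0}$ and $t\in\mathbb{Z}_{\ge0}$ such that for every $X\subseteq V$, $\sum_{x\in X}w(x)\le t$ if and only if $X$ is an independent set of $G$. A vertex cover of $G$ is a set $S\subseteq V(G)$ containing at least one endpoint of every edge; the vertex cover hypergraph $\mathcal{VC}(G)$ has vertex set $V(G)$ and as hyperedges exactly the inclusion-minimal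 vertex covers of $G$. *)

theory Defs
  imports "HOL-Library.Ramsey" "HOL-Library.Indicator_Function"
begin

record 'a hypergraph =
  vertices :: "'a set"
  hyperedges :: "'a set set"

definition hypergraph :: "'a hypergraph \<Rightarrow> bool" where
  "hypergraph H \<longleftrightarrow> finite (vertices H) \<and> hyperedges H \<subseteq> Pow (vertices H)"

definition one_sperner :: "'a hypergraph \<Rightarrow> bool" where
  "one_sperner H \<longleftrightarrow>
    (\<forall>e\<in>hyperedges H. \<forall>f\<in>hyperedges H. e \<noteq> f \<longrightarrow> min (card (e - f)) (card (f - e)) = 1)"

definition independent_in :: "'a hypergraph \<Rightarrow> 'a set \<Rightarrow> bool" where
  "independent_in H X \<longleftrightarrow> X \<subseteq> vertices H \<and> \<not> (\<exists>e\<in>hyperedges H. e \<subseteq> X)"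

definition dependent_in :: "'a hypergraph \<Rightarrow> 'a set \<Rightarrow> bool" where
  "dependent_in H X \<longleftrightarrow> X \<subseteq> vertices H \<and> (\<exists>e\<in>hyperedges H. e \<subseteq> X)"

definition threshold_hypergraph :: "'a hypergraph \<Rightarrow> bool" where
  "threshold_hypergraph H \<longleftrightarrow>
    (\<exists>(w :: 'a \<Rightarrow> nat) (t :: nat). \<forall>X \<subseteq> vertices H.
      (\<Sum>x\<in>X. w x) \<ge> t \<longleftrightarrow> (\<exists>e\<in>hyperedges H. e \<subseteq> X))"

definition two_asummable :: "'a hypergraph \<Rightarrow> bool" where
  "two_asummable H \<longleftrightarrow>
    \<not> (\<exists>A1 A2 B1 B2.
         independent_in H A1 \<and> independent_in H A2 \<and> dependent_in H B1 \<and> dependent_in H B2 \<and>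
         (\<forall>v\<in>vertices H.
            indicator A1 v + indicator A2 v = (indicator B1 v + indicator B2 v :: nat)))"

(* A graph is a hypergraph all of whose hyperedges are 2-element sets of vertices. *)
definition simple_graph :: "'a hypergraph \<Rightarrow> bool" where
  "simple_graph G \<longleftrightarrow> finite (vertices G) \<and> hyperedges G \<subseteq> [vertices G]\<^bsup>2\<^esup>"

definition threshold_graph :: "'a hypergraph \<Rightarrow> bool" where
  "threshold_graph G \<longleftrightarrow>
    (\<exists>(w :: 'a \<Rightarrow> nat) (t :: nat). \<forall>X \<subseteq> vertices G.
      (\<Sum>x\<in>X. w x) \<le> t \<longleftrightarrow> indep X (hyperedges G))"

definition vertex_cover :: "'a hypergraph \<Rightarrow> 'a set \<Rightarrow> bool" where
  "vertex_cover G S \<longleftrightarrow> S \<subseteq> vertices G \<and> (\<forall>e\<in>hyperedges G. e \<inter> S \<noteq> {})"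

definition VC :: "'a hypergraph \<Rightarrow> 'a hypergraph" where
  "VC G = \<lparr> vertices = vertices G,
            hyperedges = {S. vertex_cover G S \<and> \<not> (\<exists>T. vertex_cover G T \<and> T \<subset> S)} \<rparr>"

lemma simple_graph_imp_hypergraph: "simple_graph G \<Longrightarrow> hypergraph G"
  by (auto simp: simple_graph_def hypergraph_def nsets_def)

lemma hypergraph_VC: "simple_graph G \<Longrightarrow> hypergraph (VC G)"
  by (auto simp: simple_graph_def hypergraph_def VC_def vertex_cover_def)

end

theory Submission
  imports Defs
begin

text \<open>
  All four properties are equivalent to the absence of an alternating 4-cycle, i.e. of edges
  \<open>ab\<close>, \<open>cd\<close> with non-edges \<open>ac\<close>, \<open>bd\<close>.  A set depends in \<open>VC G\<close> iff its complement is
  independent in \<open>G\<close>; complementing therefore turns weights of a threshold graph into weights of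
  \<open>VC G\<close>, and an alternating 4-cycle into a violation of 2-asummability (complements of
  \<open>{a, c}\<close>, \<open>{b, d}\<close> against those of \<open>{a, b}\<close>, \<open>{c, d}\<close>) or of 1-Spernerness (complements of
  maximal independent sets containing \<open>{a, c}\<close> and \<open>{b, d}\<close>).  Conversely, two maximal independent
  sets differing in at least two elements on both sides are joined by a matching of size two, which
  gives an alternating 4-cycle.  Finally, without alternating 4-cycles neighbourhoods are nested, so
  there is an isolated or a dominating vertex, and weights are built by removing such vertices.
\<close>

section \<open>Alternating 4-cycles and threshold weights\<close>

text \<open>Edges and non-edges are read off an arbitrary family \<open>E\<close>, so that
  \<open>V\<close> can shrink in an induction while \<open>E\<close> stays fixed. Cases
  \<open>a = d\<close> and \<open>b = c\<close> are harmless: then \<open>{a, c}\<close> is itself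
  one of the two given edges.\<close>

definition alternating_C4_free :: "'a set \<Rightarrow> 'a set set \<Rightarrow> bool" where
  "alternating_C4_free V E \<longleftrightarrow>
    (\<forall>a\<in>V. \<forall>b\<in>V. \<forall>c\<in>V. \<forall>d\<in>V.
      a \<noteq> b \<and> c \<noteq> d \<and> a \<noteq> c \<and> b \<noteq> d \<and> {a, b} \<in> E \<and> {c, d} \<in> E \<longrightarrow> {a, c} \<in> E \<or> {b, d} \<in> E)"

lemma alternating_C4_freeD:
  assumes "alternating_C4_free V E" "a \<in> V" "b \<in> V" "c \<in> V" "d \<in> V"
    "a \<noteq> b" "c \<noteq> d" "a \<noteq> c" "b \<noteq> d" "{a, b} \<in> E" "{c, d} \<in> E"
  shows "{a, c} \<in> E \<or> {b, d} \<in> E"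
  using assms unfolding alternating_C4_free_def by blast

text \<open>Neighbourhoods are nested in the order of degrees. Therefore a vertex of minimum degree
  is isolated or a vertex of maximum degree is dominating.\<close>

lemma isolated_or_dominating:
  assumes "finite V" "V \<noteq> {}" and free: "alternating_C4_free V E"
  obtains v where "v \<in> V" "\<forall>u\<in>V - {v}. {v, u} \<notin> E"
  | v where "v \<in> V" "\<forall>u\<in>V - {v}. {v, u} \<in> E"
proof -
  define adj where "adj u v \<longleftrightarrow> u \<noteq> v \<and> {u, v} \<in> E" for u v
  define N where "N v = {x \<in> V. adj v x}" for v
  have adj_sym: "adj u v \<longleftrightarrow> adj v u" for u v
    by (auto simp: adj_def insert_commute)
  have adj_irrefl: "\<not> adj v v" for v
    by (simp add: adj_def)
  have fin: "finite (N v)" for v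
    using \<open>finite V\<close> by (simp add: N_def)
  \<comment> \<open>Suppose \<open>x\<close> is in \<open>N u\<close> but not in \<open>N v\<close>.
    Any \<open>y\<close> in \<open>N v\<close> but not in \<open>N u\<close> would close an
    alternating 4-cycle with edges \<open>ux\<close> and \<open>yv\<close>, so the reverse inclusion
    is strict. Adjacency of \<open>u\<close> and \<open>v\<close> being symmetric, the deletions
    change both degrees equally, against the degree assumption.\<close>
  have nested: "N u - {v} \<subseteq> N v - {u}"
    if uv: "u \<in> V" "v \<in> V" "card (N u) \<le> card (N v)" for u v
  proof (rule ccontr)
    assume contra: "\<not> N u - {v} \<subseteq> N v - {u}"
    then obtain x where x: "x \<in> V" "adj u x" "x \<noteq> v" "x \<noteq> u" "\<not> adj v x" "u \<noteq> v"
      using adj_irrefl unfolding N_def by blast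
    have "N v - {u} \<subseteq> N u - {v}"
    proof
      fix y assume y: "y \<in> N v - {u}"
      then have y': "y \<in> V" "adj v y" "y \<noteq> u" "y \<noteq> v"
        using adj_irrefl by (auto simp: N_def)
      show "y \<in> N u - {v}"
      proof (rule ccontr)
        assume "y \<notin> N u - {v}"
        then have "\<not> adj u y" using y' by (simp add: N_def)
        then show False
          using alternating_C4_freeD[OF free, of u x y v] x y' uv
          by (auto simp: adj_def insert_commute)
      qed
    qed
    then have "N v - {u} \<subset> N u - {v}"
      using contra by blast
    then have "card (N v - {u}) < card (N u - {v})"
      by (simp add: fin psubset_card_mono)
    moreover have "v \<in> N u \<longleftrightarrow> u \<in> N v"
      using uv adj_sym by (auto simp: N_def)
    ultimately have "card (N v) < card (N u)"
      using fin by (cases "u \<in> N v") (auto simp: card_Diff_singleton_if split: if_splits)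
    then show False using uv by simp
  qed
  let ?D = "(\<lambda>u. card (N u)) ` V"
  have D: "finite ?D" "?D \<noteq> {}" using \<open>finite V\<close> \<open>V \<noteq> {}\<close> by auto
  obtain v where "v \<in> V" "Max ?D = card (N v)"
    using Max_in[OF D] by blast
  then have v: "v \<in> V" "\<And>u. u \<in> V \<Longrightarrow> card (N u) \<le> card (N v)"
    using Max_ge[OF D(1)] by fastforce+
  obtain w where "w \<in> V" "Min ?D = card (N w)"
    using Min_in[OF D] by blast
  then have w: "w \<in> V" "\<And>u. u \<in> V \<Longrightarrow> card (N w) \<le> card (N u)"
    using Min_le[OF D(1)] by fastforce+
  \<comment> \<open>Nestedness pushes adjacency upwards: the neighbour \<open>x\<close> of
    \<open>w\<close> is also one of \<open>u\<close>, and then \<open>u\<close>, being a neighbour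
    of \<open>x\<close>, is one of \<open>v\<close>. If \<open>x = u\<close>, the neighbour
    \<open>w\<close> of \<open>u\<close> is one of \<open>v\<close>, and then \<open>v\<close>,
    being a neighbour of \<open>w\<close>, is one of \<open>u\<close>.\<close>
  have "(\<forall>u\<in>V - {w}. \<not> adj w u) \<or> (\<forall>u\<in>V - {v}. adj v u)"
  proof (rule ccontr)
    assume "\<not> ?thesis"
    then obtain x u where x: "x \<in> V" "adj w x" and u: "u \<in> V" "u \<noteq> v" "\<not> adj v u"
      by blast
    have max: "N z - {v} \<subseteq> N v - {z}" if "z \<in> V" for z
      using nested[OF that v(1)] v(2) that by blast
    have min: "N w - {u} \<subseteq> N u - {w}"
      using nested[OF w(1) u(1)] w(2) u(1) by blast
    show False
    proof (cases "x = u")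
      case True
      then have "adj v w"
        using max[OF u(1)] x u w adj_sym unfolding N_def by blast
      then show False
        using min u v adj_sym unfolding N_def by blast
    next
      case False
      then have "adj u x"
        using min x unfolding N_def by blast
      then show False
        using max[OF x(1)] u adj_sym unfolding N_def by blast
    qed
  qed
  then show thesis
    using that v(1) w(1) unfolding adj_def by (metis DiffE singletonI)
qed

text \<open>Positivity of the weights and of \<open>t\<close> strengthens the induction: it is what
  makes a dominating vertex of weight \<open>t\<close> exclude all others.\<close>

lemma alternating_C4_free_imp_weights:
  assumes "finite V" "alternating_C4_free V E"
  shows "\<exists>w t::nat. t > 0 \<and> (\<forall>x\<in>V. w x > 0) \<and> (\<forall>X\<subseteq>V. sum w X \<le> t \<longleftrightarrow> indep X E)"
  using assms
proof (induction V rule: finite_psubset_induct)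
  case (psubset V)
  show ?case
  proof (cases "V = {}")
    case True
    then show ?thesis
      by (auto simp: indep_def intro!: exI[of _ "1::nat"])
  next
    case False
    have step: "\<exists>w t::nat. t > 0 \<and> (\<forall>x\<in>V - {v}. w x > 0) \<and>
        (\<forall>X\<subseteq>V - {v}. sum w X \<le> t \<longleftrightarrow> indep X E)" if "v \<in> V" for v
      using psubset.IH[of "V - {v}"] psubset.prems that
      unfolding alternating_C4_free_def by blast
    from \<open>finite V\<close> False psubset.prems show ?thesis
    proof (cases rule: isolated_or_dominating)
      case (1 v)
      obtain w and t :: nat where w: "t > 0" "\<forall>x\<in>V - {v}. w x > 0"
        "\<And>X. X \<subseteq> V - {v} \<Longrightarrow> sum w X \<le> t \<longleftrightarrow> indep X E"
        using step[OF 1(1)] by blast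
      \<comment> \<open>Doubled weights have even sums, so under the odd bound
        \<open>2 * t + 1\<close> the single unit of the isolated \<open>v\<close> never
        matters.\<close>
      define w' where "w' x = (if x = v then 1 else 2 * w x)" for x
      have "sum w' X \<le> 2 * t + 1 \<longleftrightarrow> indep X E" if X: "X \<subseteq> V" for X
      proof -
        have fX: "finite X" using X psubset.hyps finite_subset by blast
        have "sum w' (X - {v}) = 2 * sum w (X - {v})"
          by (simp add: w'_def sum_distrib_left)
        moreover have "sum w' X = (if v \<in> X then 1 else 0) + sum w' (X - {v})"
          using fX by (cases "v \<in> X") (simp_all add: sum.remove[of X v] w'_def)
        moreover have "indep (X - {v}) E \<longleftrightarrow> indep X E"
        proof
          assume *: "indep (X - {v}) E"
          show "indep X E"
            unfolding indep_def
          proof (intro ballI impI)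
            fix x y assume "x \<in> X" "y \<in> X" "x \<noteq> y"
            then show "{x, y} \<notin> E"
              using 1 X * unfolding indep_def
              by (cases "x = v"; cases "y = v") (auto simp: insert_commute)
          qed
        qed (auto intro: smaller_indep)
        moreover have "sum w (X - {v}) \<le> t \<longleftrightarrow> indep (X - {v}) E"
          using w(3) X by blast
        ultimately show ?thesis by auto
      qed
      moreover have "\<forall>x\<in>V. w' x > 0"
        using w(2) by (simp add: w'_def)
      ultimately show ?thesis
        by (intro exI[of _ w'] exI[of _ "2 * t + 1"]) simp
    next
      case (2 v)
      obtain w and t :: nat where w: "t > 0" "\<forall>x\<in>V - {v}. w x > 0"
        "\<And>X. X \<subseteq> V - {v} \<Longrightarrow> sum w X \<le> t \<longleftrightarrow> indep X E"
        using step[OF 2(1)] by blast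
      \<comment> \<open>With weight \<open>t\<close>, the vertex \<open>v\<close> fits alone but
        with no other vertex.\<close>
      define w' where "w' = w(v := t)"
      have pos: "\<forall>x\<in>V. w' x > 0"
        using w(1,2) by (simp add: w'_def)
      have "sum w' X \<le> t \<longleftrightarrow> indep X E" if X: "X \<subseteq> V" for X
      proof (cases "v \<in> X")
        case False
        then have "sum w' X = sum w X"
          by (intro sum.cong) (auto simp: w'_def)
        then show ?thesis using w(3)[of X] X False by auto
      next
        case True
        have fX: "finite X" using X psubset.hyps finite_subset by blast
        have "sum w' X = t + sum w' (X - {v})"
          using True fX by (simp add: sum.remove[of X v] w'_def)
        then have "sum w' X \<le> t \<longleftrightarrow> (\<forall>x\<in>X - {v}. w' x = 0)"
          using fX by simp
        also have "\<dots> \<longleftrightarrow> X - {v} = {}"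
          using pos X by (metis DiffD1 all_not_in_conv empty_iff less_irrefl subsetD)
        also have "\<dots> \<longleftrightarrow> indep X E"
        proof
          assume "X - {v} = {}"
          then show "indep X E"
            unfolding indep_def by blast
        next
          assume *: "indep X E"
          have "{v, u} \<notin> E" if "u \<in> X - {v}" for u
            using * True that by (auto simp: indep_def)
          with 2 X show "X - {v} = {}" by blast
        qed
        finally show ?thesis .
      qed
      then show ?thesis
        using pos w(1) by blast
    qed
  qed
qed

section \<open>Dependence in \<open>VC G\<close> and independence in \<open>G\<close>\<close>

lemma vertex_cover_edgeD:
  assumes "vertex_cover G S" "{u, v} \<in> hyperedges G"
  shows "u \<in> S \<or> v \<in> S"
proof -
  have "{u, v} \<inter> S \<noteq> {}"
    using assms by (auto simp only: vertex_cover_def)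
  then show ?thesis by auto
qed

text \<open>By finiteness every cover shrinks to a minimal one, so containing a hyperedge means
  being a cover, that is, leaving no edge in the complement.\<close>

lemma ex_hyperedge_VC_subset_iff:
  assumes "simple_graph G" "X \<subseteq> vertices G"
  shows "(\<exists>e\<in>hyperedges (VC G). e \<subseteq> X) \<longleftrightarrow> indep (vertices G - X) (hyperedges G)"
proof -
  have "(\<exists>e\<in>hyperedges (VC G). e \<subseteq> X) \<longleftrightarrow> vertex_cover G X"
  proof
    assume "\<exists>e\<in>hyperedges (VC G). e \<subseteq> X"
    then show "vertex_cover G X"
      using assms(2) unfolding VC_def vertex_cover_def by fastforce
  next
    assume *: "vertex_cover G X"
    have "finite X"
      using finite_subset[OF assms(2)] assms(1) by (simp add: simple_graph_def)
    then show "\<exists>e\<in>hyperedges (VC G). e \<subseteq> X"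
      using *
    proof (induction X rule: finite_psubset_induct)
      case (psubset X)
      show ?case
      proof (cases "\<exists>T. vertex_cover G T \<and> T \<subset> X")
        case True
        then obtain T where "vertex_cover G T" "T \<subset> X" by blast
        with psubset.IH show ?thesis by (meson dual_order.trans psubset_imp_subset)
      next
        case False
        then show ?thesis using psubset.prems unfolding VC_def by auto
      qed
    qed
  qed
  also have "\<dots> \<longleftrightarrow> indep (vertices G - X) (hyperedges G)"
  proof
    assume *: "vertex_cover G X"
    show "indep (vertices G - X) (hyperedges G)"
      unfolding indep_def
    proof (intro ballI impI notI)
      fix u v assume "u \<in> vertices G - X" "v \<in> vertices G - X" "{u, v} \<in> hyperedges G"
      then show False
        using vertex_cover_edgeD[OF *, of u v] by simp
    qed
  next
    assume *: "indep (vertices G - X) (hyperedges G)"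
    show "vertex_cover G X"
      unfolding vertex_cover_def
    proof (intro conjI ballI notI)
      fix e assume e: "e \<in> hyperedges G" "e \<inter> X = {}"
      then have "e \<subseteq> vertices G" "card e = 2"
        using assms(1) by (auto simp: simple_graph_def nsets_def)
      then obtain u v where "e = {u, v}" "u \<noteq> v" "u \<in> vertices G" "v \<in> vertices G"
        by (auto simp: card_2_iff)
      then show False
        using e * by (auto simp: indep_def)
    qed (rule assms(2))
  qed
  finally show ?thesis .
qed

lemma vertices_VC [simp]: "vertices (VC G) = vertices G"
  by (simp add: VC_def)

lemma dependent_in_VC_iff:
  assumes "simple_graph G"
  shows "dependent_in (VC G) X \<longleftrightarrow> X \<subseteq> vertices G \<and> indep (vertices G - X) (hyperedges G)"
  using ex_hyperedge_VC_subset_iff[OF assms] by (auto simp: dependent_in_def)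

lemma independent_in_VC_iff:
  assumes "simple_graph G"
  shows "independent_in (VC G) X \<longleftrightarrow> X \<subseteq> vertices G \<and> \<not> indep (vertices G - X) (hyperedges G)"
  using ex_hyperedge_VC_subset_iff[OF assms] by (auto simp: independent_in_def)

section \<open>Threshold weights and 2-asummability\<close>

lemma threshold_graph_imp_threshold_VC:
  assumes G: "simple_graph G" and "threshold_graph G"
  shows "threshold_hypergraph (VC G)"
proof -
  let ?V = "vertices G"
  obtain w and t :: nat where w: "\<And>X. X \<subseteq> ?V \<Longrightarrow> sum w X \<le> t \<longleftrightarrow> indep X (hyperedges G)"
    using \<open>threshold_graph G\<close> unfolding threshold_graph_def by blast
  have fin: "finite ?V" using G by (simp add: simple_graph_def)
  \<comment> \<open>If \<open>t\<close> exceeds the total weight, the subtraction truncates to 0;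
    both sides then hold for every \<open>X\<close>.\<close>
  have "sum w X \<ge> sum w ?V - t \<longleftrightarrow> (\<exists>e\<in>hyperedges (VC G). e \<subseteq> X)" if X: "X \<subseteq> ?V" for X
  proof -
    have "sum w ?V = sum w (?V - X) + sum w X"
      by (rule sum.subset_diff[OF X fin])
    then show ?thesis
      using w[of "?V - X"] ex_hyperedge_VC_subset_iff[OF G X] by auto
  qed
  then show ?thesis
    unfolding threshold_hypergraph_def by auto
qed

text \<open>Weight is linear in characteristic vectors: equal sums of vectors would give equal total
  weights, yet two independent sets weigh less than \<open>2 * t\<close> and two dependent ones at
  least that.\<close>

lemma threshold_hypergraph_imp_two_asummable:
  assumes "finite (vertices H)" "threshold_hypergraph H"
  shows "two_asummable H"
  unfolding two_asummable_def
proof clarify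
  fix A1 A2 B1 B2
  assume sets: "independent_in H A1" "independent_in H A2" "dependent_in H B1" "dependent_in H B2"
    and eq: "\<forall>v\<in>vertices H.
      indicator A1 v + indicator A2 v = (indicator B1 v + indicator B2 v :: nat)"
  let ?V = "vertices H"
  obtain w and t :: nat
    where w: "\<And>X. X \<subseteq> ?V \<Longrightarrow> sum w X \<ge> t \<longleftrightarrow> (\<exists>e\<in>hyperedges H. e \<subseteq> X)"
    using assms(2) unfolding threshold_hypergraph_def by blast
  have sum: "sum w X = (\<Sum>v\<in>?V. w v * indicator X v)" if "X \<subseteq> ?V" for X
    using that assms(1) by (simp add: indicator_def sum.If_cases Int_absorb1 if_distrib cong: if_cong)
  have "sum w A1 + sum w A2 = (\<Sum>v\<in>?V. w v * (indicator A1 v + indicator A2 v))"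
    using sets by (simp add: sum independent_in_def distrib_left sum.distrib)
  also have "\<dots> = (\<Sum>v\<in>?V. w v * (indicator B1 v + indicator B2 v))"
    using eq by simp
  also have "\<dots> = sum w B1 + sum w B2"
    using sets by (simp add: sum dependent_in_def distrib_left sum.distrib)
  finally have "sum w A1 + sum w A2 = sum w B1 + sum w B2" .
  moreover have "sum w A1 < t" "sum w A2 < t" "sum w B1 \<ge> t" "sum w B2 \<ge> t"
    using sets w unfolding independent_in_def dependent_in_def by (meson not_less)+
  ultimately show False by linarith
qed

section \<open>Violations arising from an alternating 4-cycle\<close>

lemma two_asummable_VC_imp_alternating_C4_free:
  assumes G: "simple_graph G" and asum: "two_asummable (VC G)"
  shows "alternating_C4_free (vertices G) (hyperedges G)"
  unfolding alternating_C4_free_def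
proof (intro ballI impI, rule ccontr)
  let ?V = "vertices G" and ?E = "hyperedges G"
  fix a b c d
  assume V: "a \<in> ?V" "b \<in> ?V" "c \<in> ?V" "d \<in> ?V"
    and edges: "a \<noteq> b \<and> c \<noteq> d \<and> a \<noteq> c \<and> b \<noteq> d \<and> {a, b} \<in> ?E \<and> {c, d} \<in> ?E"
    and "\<not> ({a, c} \<in> ?E \<or> {b, d} \<in> ?E)"
  then have non: "{a, c} \<notin> ?E" "{b, d} \<notin> ?E" by auto
  \<comment> \<open>Now all four vertices are distinct, so \<open>{a, b}\<close>,
    \<open>{c, d}\<close> and \<open>{a, c}\<close>, \<open>{b, d}\<close> partition the same set
    and their complements have equal vector sums.\<close>
  have ne: "a \<noteq> d" "b \<noteq> c" using edges non by (auto simp: insert_commute)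
  have compl: "?V - (?V - {x, y}) = {x, y}" if "x \<in> ?V" "y \<in> ?V" for x y
    using that by auto
  have "independent_in (VC G) (?V - {a, b})" "independent_in (VC G) (?V - {c, d})"
    "dependent_in (VC G) (?V - {a, c})" "dependent_in (VC G) (?V - {b, d})"
    using V edges non
    by (auto simp: independent_in_VC_iff[OF G] dependent_in_VC_iff[OF G] compl indep_def insert_commute)
  moreover have "\<forall>v\<in>vertices (VC G). indicator (?V - {a, b}) v + indicator (?V - {c, d}) v =
      (indicator (?V - {a, c}) v + indicator (?V - {b, d}) v :: nat)"
    using edges ne by (auto simp: indicator_def)
  ultimately show False
    using asum unfolding two_asummable_def by blast
qed

text \<open>The complement of \<open>e\<close> serves as a maximal independent set extending
  \<open>I\<close>; \<open>e\<close> is found inside the cover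
  \<open>vertices G - I\<close>.\<close>

lemma VC_hyperedge_outside_subset:
  assumes G: "simple_graph G" and I: "I \<subseteq> vertices G" "indep I (hyperedges G)"
  obtains e where "e \<in> hyperedges (VC G)" "e \<inter> I = {}"
proof -
  have "vertices G - (vertices G - I) = I" using I by blast
  then show thesis
    using ex_hyperedge_VC_subset_iff[OF G, of "vertices G - I"] I that by auto
qed

lemma one_sperner_VC_imp_alternating_C4_free:
  assumes G: "simple_graph G" and sp: "one_sperner (VC G)"
  shows "alternating_C4_free (vertices G) (hyperedges G)"
  unfolding alternating_C4_free_def
proof (intro ballI impI, rule ccontr)
  let ?V = "vertices G" and ?E = "hyperedges G"
  fix a b c d
  assume V: "a \<in> ?V" "b \<in> ?V" "c \<in> ?V" "d \<in> ?V"
    and edges: "a \<noteq> b \<and> c \<noteq> d \<and> a \<noteq> c \<and> b \<noteq> d \<and> {a, b} \<in> ?E \<and> {c, d} \<in> ?E"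
    and "\<not> ({a, c} \<in> ?E \<or> {b, d} \<in> ?E)"
  then have non: "{a, c} \<notin> ?E" "{b, d} \<notin> ?E" by auto
  have "indep {a, c} ?E" "indep {b, d} ?E"
    using non by (auto simp: indep_def insert_commute)
  then obtain e f where e: "e \<in> hyperedges (VC G)" "e \<inter> {a, c} = {}"
    and f: "f \<in> hyperedges (VC G)" "f \<inter> {b, d} = {}"
    using V VC_hyperedge_outside_subset[OF G] by (metis empty_subsetI insert_subset)
  have cov: "vertex_cover G e" "vertex_cover G f"
    using e f by (auto simp: VC_def)
  \<comment> \<open>As \<open>e\<close> misses \<open>a\<close> and \<open>c\<close>, covering
    \<open>ab\<close> and \<open>cd\<close> forces \<open>b\<close> and \<open>d\<close> into it;
    symmetrically for \<open>f\<close>.\<close>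
  have "{b, d} \<subseteq> e - f" "{a, c} \<subseteq> f - e"
    using e f edges vertex_cover_edgeD[OF cov(1)] vertex_cover_edgeD[OF cov(2)] by fast+
  moreover have "finite e" "finite f"
    using cov G finite_subset[of _ "vertices G"] by (simp_all add: vertex_cover_def simple_graph_def)
  ultimately have "card {b, d} \<le> card (e - f)" "card {a, c} \<le> card (f - e)"
    by (auto intro!: card_mono)
  moreover have "e \<noteq> f" using \<open>{b, d} \<subseteq> e - f\<close> by blast
  ultimately show False
    using sp e f edges unfolding one_sperner_def by fastforce
qed

section \<open>Minimal covers without alternating 4-cycles\<close>

text \<open>By minimality, deleting \<open>v\<close> from \<open>e\<close> uncovers some edge; it
  meets \<open>e\<close> only in \<open>v\<close>, so its other end lies outside.\<close>

lemma VC_hyperedge_private_neighbour: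
  assumes G: "simple_graph G" and e: "e \<in> hyperedges (VC G)" and v: "v \<in> e"
  obtains u where "u \<in> vertices G - e" "{u, v} \<in> hyperedges G"
proof -
  have cov: "vertex_cover G e" "\<not> vertex_cover G (e - {v})"
    using e v by (auto simp: VC_def)
  then obtain g where g: "g \<in> hyperedges G" "g \<inter> (e - {v}) = {}" "g \<inter> e \<noteq> {}"
    unfolding vertex_cover_def by blast
  then have "v \<in> g" by auto
  from g(1) have sub: "g \<subseteq> vertices G" and "card g = 2"
    using G by (auto simp: simple_graph_def nsets_def)
  then have "card (g - {v}) = 1"
    using \<open>v \<in> g\<close> by simp
  then obtain u where u: "g - {v} = {u}"
    using card_1_singletonE by blast
  then have "g = {u, v}" "u \<noteq> v" "u \<in> g"
    using \<open>v \<in> g\<close> by auto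
  then show thesis
    using that[of u] g sub by auto
qed

lemma alternating_C4_free_imp_one_sperner_VC:
  assumes G: "simple_graph G" and free: "alternating_C4_free (vertices G) (hyperedges G)"
  shows "one_sperner (VC G)"
  unfolding one_sperner_def
proof (intro ballI impI)
  let ?V = "vertices G" and ?E = "hyperedges G"
  fix e f
  assume e: "e \<in> hyperedges (VC G)" and f: "f \<in> hyperedges (VC G)" and "e \<noteq> f"
  have cov: "vertex_cover G e" "vertex_cover G f"
    using e f by (auto simp: VC_def)
  then have sub: "e \<subseteq> ?V" "f \<subseteq> ?V"
    by (auto simp: vertex_cover_def)
  then have fin: "finite e" "finite f"
    using G finite_subset[OF sub(1)] finite_subset[OF sub(2)] by (simp_all add: simple_graph_def)
  have ne: "e - f \<noteq> {}" "f - e \<noteq> {}"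
    using e f \<open>e \<noteq> f\<close> cov unfolding VC_def by auto
  \<comment> \<open>The private neighbour of \<open>x\<close> lies outside \<open>e\<close>, and
    since \<open>x\<close> is not in \<open>f\<close>, the cover \<open>f\<close> must contain
    it.\<close>
  have nb_e: "\<exists>y\<in>f - e. {x, y} \<in> ?E" if x: "x \<in> e - f" for x
  proof -
    obtain z where z: "z \<in> ?V - e" "{z, x} \<in> ?E"
      using VC_hyperedge_private_neighbour[OF G e, of x] x by (metis DiffD1)
    then have "z \<in> f"
      using vertex_cover_edgeD[OF cov(2), of z x] z x by blast
    then show ?thesis
      using z by (auto simp: insert_commute)
  qed
  have nb_f: "\<exists>x\<in>e - f. {x, y} \<in> ?E" if y: "y \<in> f - e" for y
  proof -
    obtain z where z: "z \<in> ?V - f" "{z, y} \<in> ?E"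
      using VC_hyperedge_private_neighbour[OF G f, of y] y by (metis DiffD1)
    then have "z \<in> e"
      using vertex_cover_edgeD[OF cov(1), of z y] z y by blast
    then show ?thesis
      using z by (auto simp: insert_commute)
  qed
  \<comment> \<open>Both differences are independent, each avoiding a cover, so two disjoint edges
    between them form an alternating 4-cycle.\<close>
  have no_matching: False
    if "x \<in> e - f" "x' \<in> e - f" "y \<in> f - e" "y' \<in> f - e" "x \<noteq> x'" "y \<noteq> y'"
      "{x, y} \<in> ?E" "{x', y'} \<in> ?E" for x x' y y'
  proof -
    have "{x, x'} \<notin> ?E" "{y, y'} \<notin> ?E"
      using that vertex_cover_edgeD[OF cov(1)] vertex_cover_edgeD[OF cov(2)] by blast+
    then show False
      using alternating_C4_freeD[OF free, of x y x' y'] that sub by blast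
  qed
  show "min (card (e - f)) (card (f - e)) = 1"
  proof (rule ccontr)
    assume "min (card (e - f)) (card (f - e)) \<noteq> 1"
    moreover have "card (e - f) \<noteq> 0" "card (f - e) \<noteq> 0"
      using ne fin by auto
    ultimately have "\<not> card (e - f) \<le> 1" "\<not> card (f - e) \<le> 1"
      by linarith+
    then have two: "\<exists>x'\<in>e - f. x' \<noteq> x" "\<exists>y'\<in>f - e. y' \<noteq> y" for x y
      using fin by (metis card_le_Suc0_iff_eq finite_Diff One_nat_def)+
    obtain x y where xy: "x \<in> e - f" "y \<in> f - e" "{x, y} \<in> ?E"
      using ne nb_e by blast
    obtain x' y' where x': "x' \<in> e - f" "x' \<noteq> x" and y': "y' \<in> f - e" "y' \<noteq> y"
      using two by blast
    \<comment> \<open>Every edge between the differences must meet \<open>xy\<close>, so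
      \<open>x'\<close> attaches to \<open>y\<close> and \<open>y'\<close> to \<open>x\<close>;
      these two edges are themselves disjoint.\<close>
    have "{x', y} \<in> ?E" using nb_e[OF x'(1)] no_matching[OF xy(1) x'(1) xy(2)] xy x' by blast
    moreover have "{x, y'} \<in> ?E" using nb_f[OF y'(1)] no_matching[OF xy(1) _ xy(2) y'(1)] xy y' by blast
    ultimately show False
      using no_matching[OF xy(1) x'(1) y'(1) xy(2)] x' y' by blast
  qed
qed

theorem theorem3p2:
  fixes G :: "'a hypergraph"
  assumes "simple_graph G"
  shows "(threshold_graph G \<longleftrightarrow> one_sperner (VC G)) \<and>
    (threshold_graph G \<longleftrightarrow> threshold_hypergraph (VC G)) \<and>
    (threshold_graph G \<longleftrightarrow> two_asummable (VC G))"
proof -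
  have fin: "finite (vertices G)"
    using assms by (simp add: simple_graph_def)
  have "threshold_graph G" if "alternating_C4_free (vertices G) (hyperedges G)"
    using alternating_C4_free_imp_weights[OF fin that] unfolding threshold_graph_def by blast
  moreover have "two_asummable (VC G)" if "threshold_hypergraph (VC G)"
    using threshold_hypergraph_imp_two_asummable[OF _ that] fin by simp
  \<comment> \<open>The threshold and asummability properties close a cycle of implications through
    \<open>alternating_C4_free\<close>, to which \<open>one_sperner\<close> is equivalent
    directly.\<close>
  ultimately show ?thesis
    using threshold_graph_imp_threshold_VC[OF assms]
      two_asummable_VC_imp_alternating_C4_free[OF assms]
      one_sperner_VC_imp_alternating_C4_free[OF assms]
      alternating_C4_free_imp_one_sperner_VC[OF assms]
    by blast
qed

end
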